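(* Let $K$ be a finite field, let $S=K[t_1,\ldots,t_s]$, let $X=\{P_1,\ldots,P_m\}\subset K^s$ be a set of $m\ge 2$ points, let $I$ be the vanishing ideal of $X$, and let $\prec$ be a monomial order on $S$. Let $\mathcal{L}\subset S$ be a finite-dimensional linear subspace, let $\mathcal{L}_X$ be the corresponding evaluation code on $X$, and let $\mathcal{L}^\perp=(\ker(\varphi)\colon\mathcal{L})\cap K\Delta_\prec(I)$ be its algebraic dual. Then $(\mathcal{L}^\perp)_X$ is a standard monomial code on $X$ if and only if $$|(\ker(\varphi)\colon\mathcal{L})\cap\Delta_\prec(I)|=|X|-\dim_K(\mathcal{L}_X).$$
   Context: The vanishing ideal of $X$ is the ideal of polynomials vanishing on $X$. $\Delta_\prec(I)$ is the set of standard monomials of $S/I$ (monomials not in $\mathrm{in}_\prec(I)$), and $K\Delta_\prec(I)$ is its $K$-span. For a finite-dimensional linear subspace $\mathcal{M}\subset S$, the evaluation code is $\mathcal{M}_X=\{(f(P_1),\ldots,f(P_m)): f\in\mathcal{M}\}\subset K^m$. $\varphi\colon S\to K$ is $\varphi(f)=f(P_1)+\cdots+f(P_m)$, and $(\ker(\varphi)\colon\mathcal{L})=\{g\in S: g\mathcal{L}\subset\ker(\varphi)\}$. For every evaluation code $C=\mathcal{M}_X$ there is a unique linear subspace $\widetilde{\mathcal{M}}\subset K\Delta_\prec(I)$ with $\widetilde{\mathcal{M}}_X=C$, called the standard function space of $C$. The code $C$ is a standard monomial code on $X$ if its standard function space is spanned by monomials. *)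

theory Defs
  imports "HOL-Analysis.Analysis" "HOL-Library.Poly_Mapping"
begin

text \<open>
  The polynomial ring \<open>K[t\<^sub>i | i \<in> 'n]\<close> is the monoid algebra of the exponent vectors
  \<open>'n \<Rightarrow>\<^sub>0 nat\<close>; with \<open>'n\<close> finite this is the polynomial ring in \<open>s = CARD('n)\<close> variables.
\<close>

type_synonym 'n expo = "'n \<Rightarrow>\<^sub>0 nat"
type_synonym ('n, 'k) mpoly = "('n \<Rightarrow>\<^sub>0 nat) \<Rightarrow>\<^sub>0 'k"

definition monom :: "'n expo \<Rightarrow> ('n, 'k::zero_neq_one) mpoly" where
  "monom a = Poly_Mapping.single a 1"

definition scale :: "'k::comm_ring_1 \<Rightarrow> ('n, 'k) mpoly \<Rightarrow> ('n, 'k) mpoly" where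
  "scale c f = Poly_Mapping.single 0 c * f"

global_interpretation mpoly: vector_space "scale :: 'k::field \<Rightarrow> ('n, 'k) mpoly \<Rightarrow> ('n, 'k) mpoly"
proof
  fix a b :: 'k and x y :: "('n, 'k) mpoly"
  show "scale a (x + y) = scale a x + scale a y"
    by (simp add: scale_def distrib_left)
  show "scale (a + b) x = scale a x + scale b x"
    by (simp add: scale_def single_add distrib_right)
  show "scale a (scale b x) = scale (a * b) x"
    by (simp add: scale_def mult_single flip: mult.assoc)
  show "scale 1 x = x"
    by (simp add: scale_def)
qed

text \<open>A commutative ring as a module over itself: \<open>poly_ideal.span G\<close> is the ideal generated by \<open>G\<close>.\<close>

global_interpretation poly_ideal: module "(*) :: ('n, 'k::comm_ring_1) mpoly \<Rightarrow> _ \<Rightarrow> _"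
  by standard (simp_all add: distrib_left distrib_right mult.assoc)

definition finite_dim_subspace :: "('n, 'k::field) mpoly set \<Rightarrow> bool" where
  "finite_dim_subspace M \<longleftrightarrow> (\<exists>B. finite B \<and> M = mpoly.span B)"

definition mpoly_eval :: "'k::comm_ring_1 ^ 'n::finite \<Rightarrow> ('n, 'k) mpoly \<Rightarrow> 'k" where
  "mpoly_eval x f = (\<Sum>a\<in>Poly_Mapping.keys f. Poly_Mapping.lookup f a * (\<Prod>i\<in>UNIV. x $ i ^ Poly_Mapping.lookup a i))"

definition vanishing_ideal :: "('k::comm_ring_1 ^ 'n::finite) set \<Rightarrow> ('n, 'k) mpoly set" where
  "vanishing_ideal X = {f. \<forall>x\<in>X. mpoly_eval x f = 0}"

text \<open>\<open>prec a b\<close> reads \<open>t\<^sup>a \<prec> t\<^sup>b\<close>; exponent vectors are added when monomials are multiplied.\<close>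

definition monomial_order :: "('n expo \<Rightarrow> 'n expo \<Rightarrow> bool) \<Rightarrow> bool" where
  "monomial_order prec \<longleftrightarrow>
     irreflp prec \<and> transp prec \<and> totalp prec \<and> wfp prec \<and>
     (\<forall>a b c. prec a b \<longrightarrow> prec (a + c) (b + c))"

text \<open>Exponent of the initial monomial; only meaningful for \<open>f \<noteq> 0\<close>.\<close>

definition init_expo :: "('n expo \<Rightarrow> 'n expo \<Rightarrow> bool) \<Rightarrow> ('n, 'k::zero) mpoly \<Rightarrow> 'n expo" where
  "init_expo prec f =
     (THE a. a \<in> Poly_Mapping.keys f \<and> (\<forall>b\<in>Poly_Mapping.keys f. b \<noteq> a \<longrightarrow> prec b a))"

definition init_ideal ::
  "('n expo \<Rightarrow> 'n expo \<Rightarrow> bool) \<Rightarrow> ('n, 'k::comm_ring_1) mpoly set \<Rightarrow> ('n, 'k) mpoly set" where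
  "init_ideal prec I = poly_ideal.span {monom (init_expo prec f) | f. f \<in> I \<and> f \<noteq> 0}"

definition std_monomials ::
  "('n expo \<Rightarrow> 'n expo \<Rightarrow> bool) \<Rightarrow> ('n, 'k::comm_ring_1) mpoly set \<Rightarrow> ('n, 'k) mpoly set" where
  "std_monomials prec I = range monom - init_ideal prec I"

text \<open>
  A set of \<open>m\<close> points is given by an injective family \<open>P\<close> indexed by a finite type with
  \<open>m\<close> elements, so that \<open>K\<^sup>m\<close> is \<open>'k ^ 'm\<close>.
\<close>

definition eval_code ::
  "('m::finite \<Rightarrow> 'k::comm_ring_1 ^ 'n::finite) \<Rightarrow> ('n, 'k) mpoly set \<Rightarrow> ('k ^ 'm) set" where
  "eval_code P M = (\<lambda>f. \<chi> j. mpoly_eval (P j) f) ` M"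

definition eval_sum :: "('m::finite \<Rightarrow> 'k::comm_ring_1 ^ 'n::finite) \<Rightarrow> ('n, 'k) mpoly \<Rightarrow> 'k" where
  "eval_sum P f = (\<Sum>j\<in>UNIV. mpoly_eval (P j) f)"

definition ker_eval_sum ::
  "('m::finite \<Rightarrow> 'k::comm_ring_1 ^ 'n::finite) \<Rightarrow> ('n, 'k) mpoly set" where
  "ker_eval_sum P = {f. eval_sum P f = 0}"

definition colon :: "('n, 'k::comm_ring_1) mpoly set \<Rightarrow> ('n, 'k) mpoly set \<Rightarrow> ('n, 'k) mpoly set" where
  "colon A L = {g. \<forall>f\<in>L. g * f \<in> A}"

definition algebraic_dual ::
  "('m::finite \<Rightarrow> 'k::field ^ 'n::finite) \<Rightarrow> ('n expo \<Rightarrow> 'n expo \<Rightarrow> bool) \<Rightarrow>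
   ('n, 'k) mpoly set \<Rightarrow> ('n, 'k) mpoly set" where
  "algebraic_dual P prec L =
     colon (ker_eval_sum P) L \<inter> mpoly.span (std_monomials prec (vanishing_ideal (range P)))"

definition is_eval_code :: "('m::finite \<Rightarrow> 'k::field ^ 'n::finite) \<Rightarrow> ('k ^ 'm) set \<Rightarrow> bool" where
  "is_eval_code P C \<longleftrightarrow> (\<exists>M. finite_dim_subspace M \<and> C = eval_code P M)"

text \<open>For an evaluation code \<open>C\<close> (and \<open>P\<close> injective) exactly one subspace satisfies the condition below.\<close>

definition std_function_space ::
  "('m::finite \<Rightarrow> 'k::field ^ 'n::finite) \<Rightarrow> ('n expo \<Rightarrow> 'n expo \<Rightarrow> bool) \<Rightarrow>
   ('k ^ 'm) set \<Rightarrow> ('n, 'k) mpoly set" where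
  "std_function_space P prec C =
     (THE M. mpoly.subspace M \<and> M \<subseteq> mpoly.span (std_monomials prec (vanishing_ideal (range P)))
             \<and> eval_code P M = C)"

definition std_monomial_code ::
  "('m::finite \<Rightarrow> 'k::field ^ 'n::finite) \<Rightarrow> ('n expo \<Rightarrow> 'n expo \<Rightarrow> bool) \<Rightarrow> ('k ^ 'm) set \<Rightarrow> bool" where
  "std_monomial_code P prec C \<longleftrightarrow>
     is_eval_code P C \<and> (\<exists>B \<subseteq> range monom. std_function_space P prec C = mpoly.span B)"

end

theory Submission
  imports Defs
begin

text \<open>
  Let \<open>D\<close> be the span of the standard monomials, \<open>I\<close> the vanishing ideal of the points, and
  \<open>C\<close> the code of \<open>L\<close>. Evaluation at the points maps \<open>D\<close> bijectively onto \<open>K\<^sup>m\<close>. It is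
  injective there because a nonzero polynomial in \<open>D \<inter> I\<close> would have an initial monomial that is
  both standard and in the initial ideal. It is onto because interpolation realises every vector
  by some polynomial, and division with respect to \<open>I\<close> replaces that polynomial by one in \<open>D\<close>
  (\<open>bij_betw_eval_vec_std_span\<close>).

  Since evaluation is multiplicative, \<open>g\<close> lies in \<open>(ker \<phi> : L)\<close> exactly when its vector of
  values is orthogonal to \<open>C\<close>. Hence the algebraic dual \<open>N\<close> of \<open>L\<close> is the preimage in \<open>D\<close> of the
  dual code of \<open>C\<close>, and evaluation identifies \<open>N\<close> with that code, whose dimension is
  \<open>m - dim C\<close> (\<open>dim_dual_code\<close>). Moreover \<open>N\<close> is the standard function space of its own code.

  So the question is whether \<open>N\<close> is spanned by monomials. All monomials in \<open>D\<close> are standard, so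
  the monomials of \<open>N\<close> form the set \<open>T\<close> counted in the theorem, and \<open>N\<close> is spanned by monomials
  if and only if \<open>T\<close> spans it. As distinct monomials are linearly independent, this happens
  precisely when \<open>card T = dim N = m - dim C\<close>.
\<close>

section \<open>Monomials and evaluation\<close>

lemma sum_single_lookup:
  fixes f :: "'a \<Rightarrow>\<^sub>0 'b::comm_monoid_add"
  shows "(\<Sum>a\<in>Poly_Mapping.keys f. Poly_Mapping.single a (Poly_Mapping.lookup f a)) = f"
proof (rule poly_mapping_eqI)
  fix k
  show "Poly_Mapping.lookup (\<Sum>a\<in>Poly_Mapping.keys f. Poly_Mapping.single a (Poly_Mapping.lookup f a)) k
      = Poly_Mapping.lookup f k"
    by (cases "k \<in> Poly_Mapping.keys f")
      (auto simp: lookup_sum lookup_single when_def in_keys_iff intro!: sum.neutral)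
qed

lemma single_eq_scale_monom:
  "Poly_Mapping.single a (c::'k::field) = scale c (monom a)"
  by (simp add: scale_def monom_def mult_single)

lemma keys_scale_subset: "Poly_Mapping.keys (scale (c::'k::field) f) \<subseteq> Poly_Mapping.keys f"
proof -
  have "Poly_Mapping.keys (Poly_Mapping.single 0 c * f) \<subseteq> {a + b |a b. a \<in> {0} \<and> b \<in> Poly_Mapping.keys f}"
    using keys_mult[of "Poly_Mapping.single 0 c" f] by (auto split: if_splits)
  then show ?thesis
    by (auto simp: scale_def)
qed

text \<open>Every span of monomials below is handled through supports by this description: membership
  in such a span becomes a condition on the individual exponents.\<close>
lemma span_monom_image:
  "mpoly.span (monom ` A) = {f :: ('n, 'k::field) mpoly. Poly_Mapping.keys f \<subseteq> A}"
proof (intro subset_antisym subsetI)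
  fix f :: "('n, 'k) mpoly" assume f: "f \<in> mpoly.span (monom ` A)"
  have "mpoly.subspace {f :: ('n, 'k) mpoly. Poly_Mapping.keys f \<subseteq> A}"
    unfolding mpoly.subspace_def
  proof (intro conjI ballI allI)
    fix g h :: "('n, 'k) mpoly"
    assume "g \<in> {f. Poly_Mapping.keys f \<subseteq> A}" "h \<in> {f. Poly_Mapping.keys f \<subseteq> A}"
    then show "g + h \<in> {f. Poly_Mapping.keys f \<subseteq> A}" using keys_add[of g h] by blast
  next
    fix c and g :: "('n, 'k) mpoly"
    assume "g \<in> {f. Poly_Mapping.keys f \<subseteq> A}"
    then show "scale c g \<in> {f. Poly_Mapping.keys f \<subseteq> A}" using keys_scale_subset[of c g] by blast
  qed simp
  moreover have "monom ` A \<subseteq> {f :: ('n, 'k) mpoly. Poly_Mapping.keys f \<subseteq> A}"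
    by (auto simp: monom_def)
  ultimately show "f \<in> {f. Poly_Mapping.keys f \<subseteq> A}"
    using mpoly.span_minimal f by blast
next
  fix f :: "('n, 'k) mpoly" assume f: "f \<in> {f. Poly_Mapping.keys f \<subseteq> A}"
  have "(\<Sum>a\<in>Poly_Mapping.keys f. Poly_Mapping.single a (Poly_Mapping.lookup f a)) \<in> mpoly.span (monom ` A)"
    unfolding single_eq_scale_monom using f
    by (intro mpoly.span_sum mpoly.span_scale mpoly.span_base) auto
  then show "f \<in> mpoly.span (monom ` A)"
    by (simp add: sum_single_lookup)
qed

lemma independent_monomials:
  assumes "B \<subseteq> range monom"
  shows "mpoly.independent (B :: ('n, 'k::field) mpoly set)"
proof
  assume "mpoly.dependent B"
  then obtain b where b: "b \<in> B" "b \<in> mpoly.span (B - {b})"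
    by (auto simp: mpoly.dependent_def)
  then obtain a where a: "b = monom a"
    using assms by auto
  have "B - {b} \<subseteq> monom ` (UNIV - {a})"
    using assms a by auto
  then have "b \<in> mpoly.span (monom ` (UNIV - {a}))"
    using b mpoly.span_mono by blast
  then show False
    unfolding span_monom_image by (simp add: a monom_def)
qed

definition monom_value :: "'k::comm_ring_1 ^ 'n::finite \<Rightarrow> 'n expo \<Rightarrow> 'k" where
  "monom_value x a = (\<Prod>i\<in>UNIV. x $ i ^ Poly_Mapping.lookup a i)"

lemma monom_value_zero: "monom_value x 0 = 1"
  by (simp add: monom_value_def)

lemma monom_value_add: "monom_value x (a + b) = monom_value x a * monom_value x b"
  by (simp add: monom_value_def lookup_add power_add prod.distrib)

lemma monom_value_single: "monom_value x (Poly_Mapping.single i 1) = x $ i"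
proof -
  have "monom_value x (Poly_Mapping.single i 1) = (\<Prod>j\<in>UNIV. if j = i then x $ j else 1)"
    unfolding monom_value_def by (intro prod.cong) (auto simp: lookup_single when_def)
  then show ?thesis by simp
qed

text \<open>Evaluation is defined by a sum over the support, which changes under addition; summing over
  a common larger set makes additivity a termwise identity.\<close>
lemma mpoly_eval_superset:
  assumes "finite A" "Poly_Mapping.keys f \<subseteq> A"
  shows "mpoly_eval x f = (\<Sum>a\<in>A. Poly_Mapping.lookup f a * monom_value x a)"
  unfolding mpoly_eval_def monom_value_def
  using assms by (intro sum.mono_neutral_left) (auto simp: in_keys_iff)

lemma mpoly_eval_zero [simp]: "mpoly_eval x 0 = 0"
  by (simp add: mpoly_eval_def)

lemma mpoly_eval_single: "mpoly_eval x (Poly_Mapping.single a c) = c * monom_value x a"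
  by (subst mpoly_eval_superset[of "{a}"]) auto

lemma mpoly_eval_add: "mpoly_eval x (f + g) = mpoly_eval x f + mpoly_eval x g"
proof -
  let ?A = "Poly_Mapping.keys f \<union> Poly_Mapping.keys g"
  have "Poly_Mapping.keys (f + g) \<subseteq> ?A" by (rule keys_add)
  then show ?thesis
    by (simp add: mpoly_eval_superset[of ?A] lookup_add distrib_right sum.distrib)
qed

lemma mpoly_eval_sum: "mpoly_eval x (sum f A) = (\<Sum>a\<in>A. mpoly_eval x (f a))"
  by (induction A rule: infinite_finite_induct) (auto simp: mpoly_eval_add)

lemma mpoly_eval_mult: "mpoly_eval x (f * g) = mpoly_eval x f * mpoly_eval x g"
proof -
  let ?s = "\<lambda>h a. Poly_Mapping.single a (Poly_Mapping.lookup h a)"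
  have "f * g = (\<Sum>a\<in>Poly_Mapping.keys f. ?s f a) * (\<Sum>b\<in>Poly_Mapping.keys g. ?s g b)"
    by (simp add: sum_single_lookup)
  also have "\<dots> = (\<Sum>a\<in>Poly_Mapping.keys f. \<Sum>b\<in>Poly_Mapping.keys g. ?s f a * ?s g b)"
    by (simp add: sum_product)
  also have "mpoly_eval x \<dots> = (\<Sum>a\<in>Poly_Mapping.keys f. \<Sum>b\<in>Poly_Mapping.keys g.
      mpoly_eval x (?s f a) * mpoly_eval x (?s g b))"
    by (simp add: mpoly_eval_sum mult_single mpoly_eval_single monom_value_add mult_ac)
  also have "\<dots> = mpoly_eval x (\<Sum>a\<in>Poly_Mapping.keys f. ?s f a)
      * mpoly_eval x (\<Sum>b\<in>Poly_Mapping.keys g. ?s g b)"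
    by (simp add: mpoly_eval_sum sum_product)
  finally show ?thesis
    by (simp add: sum_single_lookup)
qed

lemma mpoly_eval_scale: "mpoly_eval x (scale c f) = c * mpoly_eval x f"
  by (simp add: scale_def mpoly_eval_mult mpoly_eval_single monom_value_zero)

lemma mpoly_eval_prod: "mpoly_eval x (prod f A) = (\<Prod>a\<in>A. mpoly_eval x (f a))"
proof (induction A rule: infinite_finite_induct)
  case empty
  have "mpoly_eval x (Poly_Mapping.single 0 1) = 1"
    by (simp only: mpoly_eval_single monom_value_zero mult_1_left)
  then show ?case by simp
qed (auto simp: mpoly_eval_mult mpoly_eval_single[of _ 0 1, simplified] monom_value_zero)

definition eval_vec :: "('m::finite \<Rightarrow> 'k::comm_ring_1 ^ 'n::finite) \<Rightarrow> ('n, 'k) mpoly \<Rightarrow> 'k ^ 'm" where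
  "eval_vec P f = (\<chi> j. mpoly_eval (P j) f)"

lemma eval_code_eq_image: "eval_code P M = eval_vec P ` M"
  by (simp add: eval_code_def eval_vec_def)

lemma linear_eval_vec: "Vector_Spaces.linear scale (*s) (eval_vec (P :: 'm::finite \<Rightarrow> 'k::field ^ 'n::finite))"
  by unfold_locales (auto simp: eval_vec_def vec_eq_iff mpoly_eval_add mpoly_eval_scale)

lemma vanishing_ideal_iff: "f \<in> vanishing_ideal (range P) \<longleftrightarrow> eval_vec P f = 0"
  by (auto simp: vanishing_ideal_def eval_vec_def vec_eq_iff)

lemma subspace_vanishing_ideal: "poly_ideal.subspace (vanishing_ideal X)"
  by (auto simp: poly_ideal.subspace_def vanishing_ideal_def mpoly_eval_add mpoly_eval_mult)

section \<open>Interpolation\<close>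

text \<open>Lagrange interpolation in several variables: two distinct points \<open>P\<^sub>j\<close> and \<open>P\<^sub>k\<close> differ in some
  coordinate \<open>i\<close>, so \<open>t\<^sub>i - (P\<^sub>k)\<^sub>i\<close> vanishes at \<open>P\<^sub>k\<close> but not at \<open>P\<^sub>j\<close>. Multiplying these over
  all \<open>k \<noteq> j\<close> gives a polynomial supported at \<open>P\<^sub>j\<close> only.\<close>
lemma surj_eval_vec:
  assumes "inj (P :: 'm::finite \<Rightarrow> 'k::field ^ 'n::finite)"
  shows "surj (eval_vec P)"
proof -
  have "\<forall>j k. \<exists>i. j \<noteq> k \<longrightarrow> P j $ i \<noteq> P k $ i"
    using assms by (metis injD vec_eq_iff)
  then obtain i where i: "\<And>j k. j \<noteq> k \<Longrightarrow> P j $ i j k \<noteq> P k $ i j k"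
    by metis
  define sep :: "'m \<Rightarrow> 'm \<Rightarrow> ('n, 'k) mpoly" where "sep j k = Poly_Mapping.single (Poly_Mapping.single (i j k) 1) 1
      + Poly_Mapping.single 0 (- (P k $ i j k))" for j k
  have sep: "mpoly_eval x (sep j k) = x $ i j k - P k $ i j k" for x j k
    by (simp add: sep_def mpoly_eval_add mpoly_eval_single monom_value_zero
        monom_value_single[simplified])
  define f where "f j = (\<Prod>k\<in>UNIV - {j}. sep j k)" for j
  have f0: "mpoly_eval (P k) (f j) = 0" if "k \<noteq> j" for j k
    using that unfolding f_def mpoly_eval_prod
    by (intro prod_zero) (auto simp: sep intro!: bexI[of _ k])
  have f1: "mpoly_eval (P j) (f j) \<noteq> 0" for j
    using i by (auto simp: f_def mpoly_eval_prod sep)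
  show ?thesis
  proof (rule surjI)
    fix v :: "'k ^ 'm"
    let ?g = "\<Sum>j\<in>UNIV. scale (v $ j / mpoly_eval (P j) (f j)) (f j)"
    have "mpoly_eval (P k) ?g = v $ k" for k
    proof -
      have "mpoly_eval (P k) ?g = (\<Sum>j\<in>UNIV. if j = k then v $ j else 0)"
        unfolding mpoly_eval_sum mpoly_eval_scale
        by (intro sum.cong) (auto simp: f0 f1)
      then show ?thesis by simp
    qed
    then show "eval_vec P ?g = v"
      by (simp add: eval_vec_def vec_eq_iff)
  qed
qed

section \<open>Standard monomials represent residue classes uniquely\<close>

lemma init_expo_greatest:
  assumes "monomial_order prec" "f \<noteq> 0"
  shows "init_expo prec f \<in> Poly_Mapping.keys f"
    and "\<And>b. b \<in> Poly_Mapping.keys f \<Longrightarrow> b \<noteq> init_expo prec f \<Longrightarrow> prec b (init_expo prec f)"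
proof -
  have o: "irreflp prec" "transp prec" "totalp prec"
    using assms by (auto simp: monomial_order_def)
  then have asym: "asymp prec"
    by (metis asympI irreflpD transpD)
  have "Poly_Mapping.keys f \<noteq> {}" using assms by simp
  then have "\<exists>a\<in>Poly_Mapping.keys f. \<forall>b\<in>Poly_Mapping.keys f. b \<noteq> a \<longrightarrow> prec b a"
    using o asym
    by (intro Finite_Set.bex_greatest_element)
      (auto intro: asymp_on_subset transp_on_subset totalp_on_subset)
  then have "\<exists>!a. a \<in> Poly_Mapping.keys f \<and> (\<forall>b\<in>Poly_Mapping.keys f. b \<noteq> a \<longrightarrow> prec b a)"
    using asym by (metis asympD)
  from theI'[OF this]
  show "init_expo prec f \<in> Poly_Mapping.keys f"
    and "\<And>b. b \<in> Poly_Mapping.keys f \<Longrightarrow> b \<noteq> init_expo prec f \<Longrightarrow> prec b (init_expo prec f)"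
    by (auto simp: init_expo_def)
qed

definition std_span ::
  "('n expo \<Rightarrow> 'n expo \<Rightarrow> bool) \<Rightarrow> ('n, 'k::field) mpoly set \<Rightarrow> ('n, 'k) mpoly set" where
  "std_span prec I = mpoly.span (std_monomials prec I)"

lemma keys_std_span:
  assumes "f \<in> std_span prec I" "a \<in> Poly_Mapping.keys f"
  shows "monom a \<in> std_monomials prec I"
proof -
  have "std_monomials prec I = monom ` {a. monom a \<in> std_monomials prec I}"
    by (auto simp: std_monomials_def)
  then have "f \<in> mpoly.span (monom ` {a. monom a \<in> std_monomials prec I})"
    using assms by (simp add: std_span_def)
  then show ?thesis
    using assms by (auto simp: span_monom_image)
qed

lemma std_span_Int_ideal:
  assumes "monomial_order prec" "f \<in> std_span prec I" "f \<in> I"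
  shows "f = 0"
proof (rule ccontr)
  assume f: "f \<noteq> 0"
  then have "monom (init_expo prec f) \<in> init_ideal prec I"
    using assms unfolding init_ideal_def by (auto intro!: poly_ideal.span_base)
  moreover have "monom (init_expo prec f) \<in> std_monomials prec I"
    using assms init_expo_greatest f keys_std_span by blast
  ultimately show False by (simp add: std_monomials_def)
qed

text \<open>An ideal generated by monomials contains only polynomials all of whose monomials are
  multiples of generators, since the polynomials with that property form an ideal.\<close>
lemma monom_in_init_idealE:
  assumes "monom a \<in> init_ideal prec (I :: ('n, 'k::field) mpoly set)"
  obtains f c where "f \<in> I" "f \<noteq> 0" "a = c + init_expo prec f"
proof -
  let ?M = "{h :: ('n, 'k) mpoly. \<forall>b\<in>Poly_Mapping.keys h. \<exists>f c. f \<in> I \<and> f \<noteq> 0 \<and> b = c + init_expo prec f}"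
  have "poly_ideal.subspace ?M"
    unfolding poly_ideal.subspace_def
  proof (intro conjI allI ballI)
    fix g h assume "g \<in> ?M" "h \<in> ?M"
    then show "g + h \<in> ?M" using keys_add[of g h] by blast
  next
    fix g h assume h: "h \<in> ?M"
    have "\<exists>f c. f \<in> I \<and> f \<noteq> 0 \<and> b = c + init_expo prec f" if key: "b \<in> Poly_Mapping.keys (g * h)" for b
    proof -
      obtain u v where b: "b = u + v" "v \<in> Poly_Mapping.keys h"
        using key keys_mult[of g h] by blast
      then obtain f c where "f \<in> I" "f \<noteq> 0" "v = c + init_expo prec f"
        using h by blast
      then have "b = (u + c) + init_expo prec f"
        by (simp add: b add.assoc)
      with \<open>f \<in> I\<close> \<open>f \<noteq> 0\<close> show ?thesis by blast
    qed
    then show "g * h \<in> ?M" by blast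
  qed auto
  moreover have "{monom (init_expo prec f) | f. f \<in> I \<and> f \<noteq> 0} \<subseteq> ?M"
  proof clarify
    fix f b assume "f \<in> I" "f \<noteq> 0" "b \<in> Poly_Mapping.keys (monom (init_expo prec f) :: ('n, 'k) mpoly)"
    then have "b = 0 + init_expo prec f" by (simp add: monom_def)
    with \<open>f \<in> I\<close> \<open>f \<noteq> 0\<close>
    show "\<exists>f c. f \<in> I \<and> f \<noteq> 0 \<and> b = c + init_expo prec f" by blast
  qed
  ultimately have "init_ideal prec I \<subseteq> ?M"
    unfolding init_ideal_def by (intro poly_ideal.span_minimal)
  then have "monom a \<in> ?M" using assms by blast
  then show thesis using that by (auto simp: monom_def)
qed

text \<open>Division: a nonstandard monomial is, up to a factor, the initial monomial of a multiple of
  some element of the ideal, so modulo the ideal it is a combination of smaller monomials.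
  Well-foundedness of the order ends the process.\<close>
lemma std_span_plus_ideal:
  fixes I :: "('n, 'k::field) mpoly set"
  assumes ord: "monomial_order prec" and I: "poly_ideal.subspace I"
  shows "\<exists>r\<in>std_span prec I. f - r \<in> I"
proof -
  define R where "R = {f. \<exists>r\<in>std_span prec I. f - r \<in> I}"
  have "mpoly.subspace R"
    unfolding mpoly.subspace_def
  proof (intro conjI allI ballI)
    show "0 \<in> R"
      using poly_ideal.subspace_0[OF I]
      by (auto simp: R_def std_span_def intro!: bexI[of _ 0] mpoly.span_zero)
  next
    fix f g assume "f \<in> R" "g \<in> R"
    then obtain r s where rs: "r \<in> std_span prec I" "s \<in> std_span prec I" "f - r \<in> I" "g - s \<in> I"
      by (auto simp: R_def)
    then have "r + s \<in> std_span prec I" "(f + g) - (r + s) \<in> I"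
      using poly_ideal.subspace_add[OF I rs(3,4)] mpoly.span_add
      by (auto simp: std_span_def algebra_simps)
    then show "f + g \<in> R" by (auto simp: R_def)
  next
    fix c f assume "f \<in> R"
    then obtain r where r: "r \<in> std_span prec I" "f - r \<in> I"
      by (auto simp: R_def)
    then have "scale c r \<in> std_span prec I" "scale c f - scale c r \<in> I"
      using poly_ideal.subspace_scale[OF I r(2)] mpoly.span_scale
      by (auto simp: std_span_def scale_def right_diff_distrib[symmetric])
    then show "scale c f \<in> R" by (auto simp: R_def)
  qed
  then have R_keys: "h \<in> R" if "\<And>b. b \<in> Poly_Mapping.keys h \<Longrightarrow> monom b \<in> R" for h
    using that mpoly.span_minimal[of "monom ` Poly_Mapping.keys h" R]
    by (auto simp: span_monom_image)
  have "wfp prec" using ord by (simp add: monomial_order_def)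
  then have "monom a \<in> R" for a
  proof (induction a rule: wfp_induct_rule)
    case (less a)
    show ?case
    proof (cases "monom a \<in> std_monomials prec I")
      case True
      then show ?thesis
        using poly_ideal.subspace_0[OF I]
        by (auto simp: R_def std_span_def intro!: bexI[of _ "monom a"] mpoly.span_base)
    next
      case False
      then have "monom a \<in> init_ideal prec I"
        by (simp add: std_monomials_def)
      then obtain f c where f: "f \<in> I" "f \<noteq> 0" and a: "a = c + init_expo prec f"
        by (rule monom_in_init_idealE)
      let ?e = "init_expo prec f"
      define l where "l = Poly_Mapping.lookup f ?e"
      have l: "l \<noteq> 0"
        using init_expo_greatest(1)[OF ord f(2)] by (simp add: l_def in_keys_iff)
      (* The multiple q * f of f is normalised to have leading term monom a; the remaining
         terms q * f' then have exponents below a. *)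
      define f' where "f' = f - Poly_Mapping.single ?e l"
      define q where "q = Poly_Mapping.single c (1 / l)"
      have key: "b \<in> Poly_Mapping.keys f \<and> b \<noteq> ?e" if "b \<in> Poly_Mapping.keys f'" for b
        using that by (auto simp: f'_def l_def in_keys_iff lookup_minus lookup_single when_def split: if_splits)
      have "q * f' \<in> R"
      proof (rule R_keys)
        fix b assume "b \<in> Poly_Mapping.keys (q * f')"
        then obtain u where u: "u \<in> Poly_Mapping.keys f'" "b = c + u"
          using keys_mult[of q f'] by (auto simp: q_def split: if_splits)
        then have "prec u ?e"
          using key init_expo_greatest(2)[OF ord f(2)] by blast
        then have "prec (u + c) (?e + c)"
          using ord by (auto simp: monomial_order_def)
        then have "prec b a"
          by (simp add: u a add.commute)
        then show "monom b \<in> R" by (rule less.IH)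
      qed
      then have "scale (-1) (q * f') \<in> R"
        by (rule mpoly.subspace_scale[OF \<open>mpoly.subspace R\<close>])
      then obtain r where r: "r \<in> std_span prec I" "- (q * f') - r \<in> I"
        by (auto simp: R_def scale_def single_uminus)
      have "monom a = q * f - q * f'"
        using l by (simp add: f'_def right_diff_distrib q_def mult_single a monom_def)
      then have "monom a - r = q * f + (- (q * f') - r)"
        by simp
      also have "\<dots> \<in> I"
        using poly_ideal.subspace_add[OF I poly_ideal.subspace_scale[OF I f(1)] r(2)] .
      finally show ?thesis
        using r(1) by (auto simp: R_def)
    qed
  qed
  then have "f \<in> R" by (rule R_keys)
  then show ?thesis by (simp add: R_def)
qed

lemma bij_betw_eval_vec_std_span:
  assumes "inj (P :: 'm::finite \<Rightarrow> 'k::field ^ 'n::finite)" and ord: "monomial_order prec"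
  shows "bij_betw (eval_vec P) (std_span prec (vanishing_ideal (range P))) UNIV"
proof -
  interpret E: Vector_Spaces.linear scale "(*s)" "eval_vec P"
    by (rule linear_eval_vec)
  let ?D = "std_span prec (vanishing_ideal (range P))"
  have "inj_on (eval_vec P) ?D"
  proof (rule inj_onI)
    fix f g assume fg: "f \<in> ?D" "g \<in> ?D" "eval_vec P f = eval_vec P g"
    then have "f - g \<in> ?D" "f - g \<in> vanishing_ideal (range P)"
      by (auto simp: std_span_def mpoly.span_diff vanishing_ideal_iff E.diff)
    then show "f = g" using std_span_Int_ideal[OF ord] by fastforce
  qed
  moreover have "v \<in> eval_vec P ` ?D" for v
  proof -
    obtain f where "v = eval_vec P f"
      using surj_eval_vec[OF assms(1)] by (metis surjD)
    moreover obtain r where "r \<in> ?D" "f - r \<in> vanishing_ideal (range P)"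
      using std_span_plus_ideal[OF ord subspace_vanishing_ideal] by blast
    ultimately show ?thesis by (auto simp: vanishing_ideal_iff E.diff)
  qed
  ultimately show ?thesis by (auto simp: bij_betw_def)
qed

section \<open>The dual code\<close>

definition dual_code :: "('k::field ^ 'm::finite) set \<Rightarrow> ('k ^ 'm) set" where
  "dual_code C = {x. \<forall>y\<in>C. (\<Sum>j\<in>UNIV. x $ j * y $ j) = 0}"

lemma subspace_annihilator:
  "vec.subspace {x :: 'k::field ^ 'm::finite. (\<Sum>j\<in>UNIV. x $ j * y $ j) = 0}"
  by (auto simp: vec.subspace_def distrib_right sum.distrib mult.assoc simp flip: sum_distrib_left)

lemma subspace_dual_code: "vec.subspace (dual_code C)"
proof -
  have "dual_code C = \<Inter> ((\<lambda>y. {x. (\<Sum>j\<in>UNIV. x $ j * y $ j) = 0}) ` C)"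
    by (auto simp: dual_code_def)
  then show ?thesis
    by (auto intro!: vec.subspace_Inter subspace_annihilator)
qed

text \<open>Extend a basis \<open>A\<close> for the span of \<open>C\<close> to a basis \<open>B\<close> of the whole space, and take the basis
  dual to \<open>B\<close> for the bilinear form. The members dual to vectors outside \<open>A\<close> are a basis of
  the dual code.\<close>
lemma dim_dual_code:
  fixes C :: "('k::field ^ 'm::finite) set"
  shows "vec.dim (dual_code C) = CARD('m) - vec.dim C"
proof -
  define dot :: "'k ^ 'm \<Rightarrow> 'k ^ 'm \<Rightarrow> 'k" where "dot x y = (\<Sum>j\<in>UNIV. x $ j * y $ j)" for x y
  obtain A where A: "A \<subseteq> C" "vec.independent A" "C \<subseteq> vec.span A" "card A = vec.dim C"
    by (rule vec.basis_exists)
  define B where "B = vec.extend_basis A"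
  have B: "A \<subseteq> B" "vec.independent B" "vec.span B = UNIV"
    using A(2) by (auto simp: B_def vec.extend_basis_superset vec.independent_extend_basis)
  have finB: "finite B" using B vec.finiteI_independent by blast
  have cardB: "card B = CARD('m)"
    using vec.dim_eq_card[of B UNIV] B vec_dim_card by (metis vec.span_UNIV)
  (* The Riesz vector of the b-th coordinate functional with respect to B; as b ranges
     over B, these vectors form the dual basis. *)
  define w :: "'k ^ 'm \<Rightarrow> 'k ^ 'm" where "w b = (\<chi> j. vec.representation B (axis j 1) b)" for b
  have dotw: "dot x (w b) = vec.representation B x b" for x b
  proof -
    have "vec.representation B x b = vec.representation B (\<Sum>j\<in>UNIV. x $ j *s axis j 1) b"
      by (simp add: basis_expansion)
    also have "\<dots> = (\<Sum>j\<in>UNIV. vec.representation B (x $ j *s axis j 1) b)"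
      using B by (subst vec.representation_sum) auto
    also have "\<dots> = dot x (w b)"
      using B by (simp add: vec.representation_scale dot_def w_def)
    finally show ?thesis by simp
  qed
  have dot_comm: "dot x y = dot y x" for x y
    by (simp add: dot_def mult.commute)
  have dot_w_basis: "dot (w b) b' = (if b = b' then 1 else 0)" if "b' \<in> B" for b b'
    using that B by (simp add: dot_comm[of "w b"] dotw vec.representation_basis)
  have expand: "x = (\<Sum>b\<in>B. dot x b *s w b)" for x
  proof -
    have "x $ j = (\<Sum>b\<in>B. dot x b * w b $ j)" for j
    proof -
      have "(\<Sum>b\<in>B. dot x b * w b $ j) = (\<Sum>b\<in>B. \<Sum>i\<in>UNIV. x $ i * (w b $ j * b $ i))"
        by (simp add: dot_def sum_distrib_left sum_distrib_right mult_ac)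
      also have "\<dots> = (\<Sum>i\<in>UNIV. x $ i * (\<Sum>b\<in>B. vec.representation B (axis j 1) b *s b) $ i)"
        by (subst sum.swap) (simp add: sum_distrib_left w_def)
      also have "\<dots> = (\<Sum>i\<in>UNIV. x $ i * (axis j 1 :: 'k ^ 'm) $ i)"
        using B finB by (subst vec.sum_representation_eq) auto
      also have "\<dots> = x $ j" by (simp add: axis_def if_distrib cong: if_cong)
      finally show ?thesis by simp
    qed
    then show ?thesis by (simp add: vec_eq_iff)
  qed
  have "inj_on w B"
    by (rule inj_onI) (metis dot_w_basis zero_neq_one)
  let ?W = "w ` (B - A)"
  have "vec.independent ?W"
  proof
    assume "vec.dependent ?W"
    then obtain b where b: "b \<in> B" "w b \<in> vec.span (?W - {w b})"
      by (auto simp: vec.dependent_def)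
    have "?W - {w b} \<subseteq> {x. dot x b = 0}"
      using b dot_w_basis by auto
    then have "vec.span (?W - {w b}) \<subseteq> {x. dot x b = 0}"
      using subspace_annihilator[of b] by (intro vec.span_minimal) (auto simp: dot_def)
    then show False using b dot_w_basis[of b b] by auto
  qed
  moreover have "?W \<subseteq> dual_code C"
  proof -
    have "dot (w b) y = 0" if b: "b \<in> B - A" and "y \<in> C" for b y
    proof -
      have "A \<subseteq> {y. dot y (w b) = 0}"
        using b B dot_w_basis by (auto simp: dot_comm[of _ "w b"])
      then have "vec.span A \<subseteq> {y. dot y (w b) = 0}"
        using subspace_annihilator[of "w b"] by (intro vec.span_minimal) (auto simp: dot_def)
      then show ?thesis using \<open>y \<in> C\<close> A(3) dot_comm by auto
    qed
    then show ?thesis by (auto simp: dual_code_def dot_def)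
  qed
  moreover have "dual_code C \<subseteq> vec.span ?W"
  proof
    fix x assume "x \<in> dual_code C"
    then have "dot x b = 0" if "b \<in> A" for b
      using that A(1) by (auto simp: dual_code_def dot_def)
    then have "(\<Sum>b\<in>B. dot x b *s w b) = (\<Sum>b\<in>B - A. dot x b *s w b)"
      using finB by (intro sum.mono_neutral_right) auto
    then have "x = (\<Sum>b\<in>B - A. dot x b *s w b)" using expand[of x] by simp
    moreover have "(\<Sum>b\<in>B - A. dot x b *s w b) \<in> vec.span ?W"
      by (intro vec.span_sum vec.span_scale vec.span_base) auto
    ultimately show "x \<in> vec.span ?W" by simp
  qed
  moreover have "card ?W = CARD('m) - vec.dim C"
    using \<open>inj_on w B\<close> B(1) A(4) finB cardB
    by (subst card_image) (auto intro: inj_on_subset simp: card_Diff_subset finite_subset)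
  ultimately show ?thesis
    using vec.basis_card_eq_dim by metis
qed

section \<open>The algebraic dual as a standard function space\<close>

text \<open>Evaluation is multiplicative, so \<open>\<phi>(g f)\<close> is the standard bilinear form applied to the value
  vectors of \<open>g\<close> and \<open>f\<close>.\<close>
lemma colon_ker_eval_sum_iff:
  "g \<in> colon (ker_eval_sum P) L \<longleftrightarrow> eval_vec P g \<in> dual_code (eval_code P L)"
  by (simp add: colon_def ker_eval_sum_def eval_sum_def mpoly_eval_mult dual_code_def
      eval_code_eq_image eval_vec_def)

lemma algebraic_dual_eq:
  "algebraic_dual P prec L =
    {g \<in> std_span prec (vanishing_ideal (range P)). eval_vec P g \<in> dual_code (eval_code P L)}"
  by (auto simp: algebraic_dual_def std_span_def colon_ker_eval_sum_iff)

lemma eval_code_algebraic_dual: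
  assumes "inj P" "monomial_order prec"
  shows "eval_code P (algebraic_dual P prec L) = dual_code (eval_code P L)"
proof -
  have "y \<in> eval_vec P ` std_span prec (vanishing_ideal (range P))" for y
    using bij_betw_eval_vec_std_span[OF assms] by (auto simp: bij_betw_def)
  then show ?thesis
    by (fastforce simp: eval_code_eq_image algebraic_dual_eq)
qed

lemma subspace_algebraic_dual:
  "mpoly.subspace (algebraic_dual P prec L)"
proof -
  interpret E: Vector_Spaces.linear scale "(*s)" "eval_vec P"
    by (rule linear_eval_vec)
  have "mpoly.subspace (std_span prec (vanishing_ideal (range P)) \<inter> eval_vec P -` dual_code (eval_code P L))"
    unfolding std_span_def
    by (intro mpoly.subspace_inter mpoly.subspace_span E.subspace_vimage subspace_dual_code)
  also have "std_span prec (vanishing_ideal (range P)) \<inter> eval_vec P -` dual_code (eval_code P L)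
      = algebraic_dual P prec L"
    by (auto simp: algebraic_dual_eq)
  finally show ?thesis .
qed

text \<open>Uniqueness of the standard function space comes from injectivity of evaluation on the span
  of the standard monomials: subspaces of it with equal images are equal.\<close>
lemma std_function_space_eval_code:
  assumes "inj P" "monomial_order prec"
    and M: "mpoly.subspace M" "M \<subseteq> std_span prec (vanishing_ideal (range P))"
  shows "std_function_space P prec (eval_code P M) = M"
proof -
  have "inj_on (eval_vec P) (std_span prec (vanishing_ideal (range P)))"
    using bij_betw_eval_vec_std_span[OF assms(1,2)] by (simp add: bij_betw_def)
  then show ?thesis
    unfolding std_function_space_def
    using M by (intro the_equality) (auto simp: eval_code_eq_image std_span_def inj_on_image_eq_iff)
qed

theorem proposition3p10:
  fixes P :: "'m::finite \<Rightarrow> 'k::{field,finite} ^ 'n::finite"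
    and prec :: "'n expo \<Rightarrow> 'n expo \<Rightarrow> bool"
    and L :: "('n, 'k) mpoly set"
  assumes "inj P" and "CARD('m) \<ge> 2"
    and "monomial_order prec"
    and "finite_dim_subspace L"
  shows "std_monomial_code P prec (eval_code P (algebraic_dual P prec L)) \<longleftrightarrow>
    int (card (colon (ker_eval_sum P) L \<inter> std_monomials prec (vanishing_ideal (range P))))
      = int (card (range P)) - int (vec.dim (eval_code P L))"
proof -
  interpret E: Vector_Spaces.linear scale "(*s)" "eval_vec P"
    by (rule linear_eval_vec)
  let ?D = "std_span prec (vanishing_ideal (range P))"
  define N where "N = algebraic_dual P prec L"
  define T where "T = colon (ker_eval_sum P) L \<inter> std_monomials prec (vanishing_ideal (range P))"
  have N: "mpoly.subspace N" "N \<subseteq> ?D"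
    unfolding N_def by (rule subspace_algebraic_dual) (auto simp: algebraic_dual_eq)
  have inj: "inj_on (eval_vec P) ?D"
    using bij_betw_eval_vec_std_span[OF assms(1,3)] by (simp add: bij_betw_def)
  have EN: "eval_vec P ` N = dual_code (eval_code P L)"
    using eval_code_algebraic_dual[OF assms(1,3)] by (simp add: N_def eval_code_eq_image)
  (* Over a finite field N is a finite set, so the subspace N is the span of a finite set, itself. *)
  have "finite N"
    using finite_imageD[OF _ inj_on_subset[OF inj N(2)]] by simp
  then have "finite_dim_subspace N"
    unfolding finite_dim_subspace_def using N(1) by (metis mpoly.span_eq_iff)
  then have code: "std_monomial_code P prec (eval_code P N) \<longleftrightarrow>
      (\<exists>B\<subseteq>range monom. N = mpoly.span B)"
    using std_function_space_eval_code[OF assms(1,3) N]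
    by (auto simp: std_monomial_code_def is_eval_code_def)
  have T: "T = N \<inter> range monom"
  proof -
    have "monom a \<in> ?D \<longleftrightarrow> monom a \<in> std_monomials prec (vanishing_ideal (range P))" for a
      using keys_std_span[of "monom a" prec "vanishing_ideal (range P)" a]
      by (auto simp: std_span_def monom_def intro: mpoly.span_base)
    then show ?thesis
      by (auto simp: T_def N_def algebraic_dual_def std_monomials_def std_span_def)
  qed
  have spanT: "mpoly.span T \<subseteq> N"
    using T N(1) by (intro mpoly.span_minimal) auto
  then have spanT_D: "mpoly.span T \<subseteq> ?D"
    using N(2) by blast
  have "(\<exists>B\<subseteq>range monom. N = mpoly.span B) \<longleftrightarrow> mpoly.span T = N"
  proof
    assume "\<exists>B\<subseteq>range monom. N = mpoly.span B"
    then obtain B where B: "B \<subseteq> range monom" "N = mpoly.span B" by blast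
    then have "B \<subseteq> T" using T mpoly.span_superset by blast
    then show "mpoly.span T = N" using spanT B mpoly.span_mono by blast
  qed (use T in blast)
  also have "\<dots> \<longleftrightarrow> eval_vec P ` mpoly.span T = eval_vec P ` N"
    using inj_on_image_eq_iff[OF inj spanT_D N(2)] by simp
  also have "\<dots> \<longleftrightarrow> vec.span (eval_vec P ` T) = dual_code (eval_code P L)"
    by (simp add: E.span_image EN)
  also have "\<dots> \<longleftrightarrow> card T = vec.dim (dual_code (eval_code P L))"
  proof -
    have "mpoly.independent T"
      using T by (intro independent_monomials) auto
    then have "vec.independent (eval_vec P ` T)"
      using inj_on_subset[OF inj spanT_D] E.independent_injective_image by blast
    moreover have "card (eval_vec P ` T) = card T"
      using inj N(2) T by (intro card_image) (auto intro: inj_on_subset)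
    ultimately have d: "vec.dim (vec.span (eval_vec P ` T)) = card T"
      by (simp add: vec.dim_eq_card_independent)
    have "vec.span (eval_vec P ` T) \<subseteq> dual_code (eval_code P L)"
      using spanT EN by (auto simp: E.span_image)
    then show ?thesis
      using vec.subspace_dim_equal[OF vec.subspace_span subspace_dual_code] d by (metis order_refl)
  qed
  also have "\<dots> \<longleftrightarrow> int (card T) = int (card (range P)) - int (vec.dim (eval_code P L))"
  proof -
    have "vec.dim (eval_code P L) \<le> CARD('m)"
      using vec.dim_subset[OF subset_UNIV, of "eval_code P L"] by (simp only: vec_dim_card)
    then show ?thesis
      using assms(1) by (auto simp: dim_dual_code card_image)
  qed
  finally show ?thesis
    using code by (simp add: T_def N_def)
qed

end
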